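(* Let $M$ be a fixed integer. Then for any $a,b,c\in\mathbb{Z}$ the set $\mathcal{R}_H(a,b,c)\cap(-\infty,M]$ is finite.
   Context: Define three maps $\mathbb{Z}^3\to\mathbb{Z}^3$ by $H'(x,y,z)=(-x+1+y+z,\,y,\,z)$, $H''(x,y,z)=(x,\,-y+1+z+x,\,z)$, $H'''(x,y,z)=(x,\,y,\,-z+1+x+y)$. For $(a,b,c)\in\mathbb{Z}^3$, let $\mathcal{T}_H(a,b,c)$ be the set of all triples obtained from $(a,b,c)$ by applying any finite sequence (possibly empty) of the maps $H',H'',H'''$, in any order. Let $\mathcal{R}_H(a,b,c)=\{m\in\mathbb{Z}: m \text{ is a component of some triple in } \mathcal{T}_H(a,b,c)\}$ (the integers represented by $(a,b,c)$). *)

theory Defs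
  imports Main
begin

definition H1 :: "int \<times> int \<times> int \<Rightarrow> int \<times> int \<times> int" where
  "H1 = (\<lambda>(x, y, z). (- x + 1 + y + z, y, z))"

definition H2 :: "int \<times> int \<times> int \<Rightarrow> int \<times> int \<times> int" where
  "H2 = (\<lambda>(x, y, z). (x, - y + 1 + z + x, z))"

definition H3 :: "int \<times> int \<times> int \<Rightarrow> int \<times> int \<times> int" where
  "H3 = (\<lambda>(x, y, z). (x, y, - z + 1 + x + y))"

inductive_set T_H :: "int \<Rightarrow> int \<Rightarrow> int \<Rightarrow> (int \<times> int \<times> int) set"
  for a b c :: int where
  base: "(a, b, c) \<in> T_H a b c"
| step1: "t \<in> T_H a b c \<Longrightarrow> H1 t \<in> T_H a b c"
| step2: "t \<in> T_H a b c \<Longrightarrow> H2 t \<in> T_H a b c"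
| step3: "t \<in> T_H a b c \<Longrightarrow> H3 t \<in> T_H a b c"

definition R_H :: "int \<Rightarrow> int \<Rightarrow> int \<Rightarrow> int set" where
  "R_H a b c = {m. \<exists>(x, y, z) \<in> T_H a b c. m = x \<or> m = y \<or> m = z}"

end

theory Submission
  imports Defs
begin

text \<open>
  Each of the three maps exchanges the two roots of \<open>x\<^sup>2 + y\<^sup>2 + z\<^sup>2 - xy - yz - zx - x - y - z = k\<close>,
  viewed as a quadratic equation in one of the variables, so this expression is constant on
  the whole tree. With \<open>p = x - y + 1\<close> and \<open>q = x - z + 1\<close> the equation becomes
  \<open>3x + k + 1 = p\<^sup>2 - pq + q\<^sup>2\<close>, which is nonnegative. Hence the components are bounded below.
\<close>

definition H_form :: "int \<times> int \<times> int \<Rightarrow> int" where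
  "H_form = (\<lambda>(x, y, z). x\<^sup>2 + y\<^sup>2 + z\<^sup>2 - x * y - y * z - z * x - x - y - z)"

lemma H_form_H:
  "H_form (H1 t) = H_form t" "H_form (H2 t) = H_form t" "H_form (H3 t) = H_form t"
  by (cases t; simp add: H_form_def H1_def H2_def H3_def power2_eq_square algebra_simps)+

lemma H_form_T_H: "t \<in> T_H a b c \<Longrightarrow> H_form t = H_form (a, b, c)"
  by (induction rule: T_H.induct) (simp_all add: H_form_H)

text \<open>Twice this form is a sum of three squares. It is the norm of \<open>p + q * w\<close>
  for a primitive cube root of unity \<open>w\<close>.\<close>

lemma Eisenstein_norm_nonneg: "0 \<le> p\<^sup>2 - p * q + q\<^sup>2" for p q :: int
proof -
  have "0 \<le> p\<^sup>2 + q\<^sup>2 + (p - q)\<^sup>2"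
    by simp
  also have "\<dots> = 2 * (p\<^sup>2 - p * q + q\<^sup>2)"
    by (simp add: power2_eq_square algebra_simps)
  finally show ?thesis
    by (simp only: zero_le_mult_iff) simp
qed

lemma H_form_lower_bound: "- 1 - H_form (x, y, z) \<le> 3 * x"
proof -
  have "0 \<le> (x - y + 1)\<^sup>2 - (x - y + 1) * (x - z + 1) + (x - z + 1)\<^sup>2"
    by (rule Eisenstein_norm_nonneg)
  also have "\<dots> = 3 * x + H_form (x, y, z) + 1"
    by (simp add: H_form_def power2_eq_square algebra_simps)
  finally show ?thesis
    by linarith
qed

text \<open>Cyclic symmetry carries the bound on the first component over to the other two.\<close>

lemma H_form_rotate: "H_form (y, z, x) = H_form (x, y, z)"
  by (simp add: H_form_def algebra_simps)

lemma R_H_lower_bound: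
  assumes "m \<in> R_H a b c"
  shows "- 1 - H_form (a, b, c) \<le> 3 * m"
proof -
  obtain x y z where t: "(x, y, z) \<in> T_H a b c" and m: "m = x \<or> m = y \<or> m = z"
    using assms by (auto simp: R_H_def)
  have "H_form (x, y, z) = H_form (a, b, c)"
    using t by (rule H_form_T_H)
  then show ?thesis
    using m H_form_lower_bound[of x y z] H_form_lower_bound[of y z x] H_form_lower_bound[of z x y]
      H_form_rotate[of x y z] H_form_rotate[of y z x] by auto
qed

theorem theorem1p1:
  fixes M a b c :: int
  shows "finite (R_H a b c \<inter> {..M})"
proof (rule finite_subset)
  show "R_H a b c \<inter> {..M} \<subseteq> {(- 1 - H_form (a, b, c)) div 3..M}"
  proof
    fix m assume m: "m \<in> R_H a b c \<inter> {..M}"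
    then have "- 1 - H_form (a, b, c) \<le> 3 * m"
      by (simp add: R_H_lower_bound)
    \<comment> \<open>\<open>div\<close> rounds down, which can only weaken the lower bound;
      finiteness needs no sharp endpoint.\<close>
    then have "(- 1 - H_form (a, b, c)) div 3 \<le> m"
      by linarith
    with m show "m \<in> {(- 1 - H_form (a, b, c)) div 3..M}"
      by simp
  qed
qed simp

end
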